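(* Let $G$ be a finite simple graph and let $A \subseteq V(G)$ be a non-empty set such that the induced subgraph $G[A]$ is connected. Then for each integer $r \geq 1$, the simplicial complex $\Sigma_r(A,G)$ is vertex decomposable.
   Context: For a finite simple graph $G$, a positive integer $r$ and $A\subseteq V(G)$, the $r$-support of $A$ is $\mathrm{Supp}_r(A,G)=\{F\subseteq V(G): |F|=r,\ F\cap A=\emptyset,\ G[F\cup A]\text{ is connected}\}$. The $r$-co-connected complex of $G$ with respect to $A$ is the simplicial complex $\Sigma_r(A,G)=\langle F^c\setminus A : F\in \mathrm{Supp}_r(A,G)\rangle$ generated by these sets, where $F^c=V(G)\setminus F$ (if $\mathrm{Supp}_r(A,G)=\emptyset$ it is the void complex, i.e. the complex with no faces). A simplicial complex $\Delta$ is vertex decomposable if it is a simplex, or the empty complex $\{\emptyset\}$, or the void complex, or there is a vertex $x$ such that $\mathrm{lk}_\Delta(x)=\{H\in\Delta: x\notin H,\ H\cup\{x\}\in\Delta\}$ and $\mathrm{del}_\Delta(x)=\{H\in\Delta : x\notin H\}$ are vertex decomposable and every facet of $\mathrm{del}_\Delta(x)$ is a facet of $\Delta$. *)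

theory Defs
  imports "Graph_Theory.Digraph_Component"
begin

text \<open>
  A finite simple graph is rendered by the locale predicate \<open>graph\<close>: a finite, loop-free,
  symmetric digraph without parallel arcs, each undirected edge being a pair of opposite arcs.
  \<open>G \<restriction> W\<close> is the subgraph induced on \<open>W\<close>; \<open>connected\<close> requires at least one vertex.
\<close>

definition supp :: "nat \<Rightarrow> 'a set \<Rightarrow> ('a, 'b) pre_digraph \<Rightarrow> 'a set set" where
  "supp r A G = {F. F \<subseteq> verts G \<and> card F = r \<and> F \<inter> A = {} \<and> connected (G \<restriction> (F \<union> A))}"

text \<open>
  A simplicial complex is the set of its faces, and its vertices are the \<open>x\<close> with \<open>{x}\<close> a face.
  Both \<open>{}\<close> (the void complex) and \<open>{{}}\<close> (the empty complex) are allowed.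
\<close>

definition simplicial_complex :: "'a set set \<Rightarrow> bool" where
  "simplicial_complex \<Delta> \<longleftrightarrow> finite (\<Union>\<Delta>) \<and> (\<forall>F\<in>\<Delta>. \<forall>H. H \<subseteq> F \<longrightarrow> H \<in> \<Delta>)"

definition generated_complex :: "'a set set \<Rightarrow> 'a set set" where
  "generated_complex S = {H. \<exists>F\<in>S. H \<subseteq> F}"

definition facets :: "'a set set \<Rightarrow> 'a set set" where
  "facets \<Delta> = {F \<in> \<Delta>. \<forall>H\<in>\<Delta>. F \<subseteq> H \<longrightarrow> H = F}"

definition link :: "'a set set \<Rightarrow> 'a \<Rightarrow> 'a set set" where
  "link \<Delta> x = {H \<in> \<Delta>. x \<notin> H \<and> H \<union> {x} \<in> \<Delta>}"

definition deletion :: "'a set set \<Rightarrow> 'a \<Rightarrow> 'a set set" where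
  "deletion \<Delta> x = {H \<in> \<Delta>. x \<notin> H}"

inductive vertex_decomposable :: "'a set set \<Rightarrow> bool" where
  simplex: "finite S \<Longrightarrow> vertex_decomposable (Pow S)"
| empty_complex: "vertex_decomposable {{}}"
| void_complex: "vertex_decomposable {}"
| shedding_vertex:
    "\<lbrakk>simplicial_complex \<Delta>; {x} \<in> \<Delta>;
      vertex_decomposable (link \<Delta> x); vertex_decomposable (deletion \<Delta> x);
      facets (deletion \<Delta> x) \<subseteq> facets \<Delta>\<rbrakk>
     \<Longrightarrow> vertex_decomposable \<Delta>"

definition co_connected_complex :: "nat \<Rightarrow> 'a set \<Rightarrow> ('a, 'b) pre_digraph \<Rightarrow> 'a set set" where
  "co_connected_complex r A G = generated_complex {(verts G - F) - A | F. F \<in> supp r A G}"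

end

theory Submission
  imports Defs
begin

text \<open>
  The sets \<open>F\<close> disjoint from \<open>A\<close> for which \<open>G[F \<union> A]\<close> is connected are the feasible sets of a
  greedoid, and \<open>\<Sigma>\<^sub>r(A, G)\<close> is generated by the complements of its feasible sets of size \<open>r\<close>.
  Such a complex is vertex decomposable for every greedoid: any feasible singleton \<open>{x}\<close> gives a
  shedding vertex \<open>x\<close> (or \<open>x\<close> is in no face, and the complex is its own deletion), since the link of \<open>x\<close> comes from the restriction of the greedoid to \<open>E - {x}\<close>
  (same \<open>r\<close>) and the deletion of \<open>x\<close> from its contraction by \<open>x\<close> (with \<open>r - 1\<close>). The latter holds
  because augmentation enlarges \<open>{x}\<close> inside \<open>{x} \<union> F\<close> to a feasible set of size \<open>card F\<close>.
\<close>

section \<open>Dual complexes of greedoids\<close>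

text \<open>Accessibility is built in: augmenting \<open>{}\<close> from a feasible \<open>X\<close>
  builds \<open>X\<close> one element at a time.\<close>

definition greedoid :: "'a set \<Rightarrow> 'a set set \<Rightarrow> bool" where
  "greedoid E \<F> \<longleftrightarrow> finite E \<and> \<F> \<subseteq> Pow E \<and> {} \<in> \<F> \<and>
     (\<forall>X\<in>\<F>. \<forall>Y\<in>\<F>. card Y < card X \<longrightarrow> (\<exists>x\<in>X - Y. insert x Y \<in> \<F>))"

text \<open>For a matroid of rank \<open>r\<close> this is the independence complex of the dual
  matroid.\<close>

definition dual_complex :: "nat \<Rightarrow> 'a set \<Rightarrow> 'a set set \<Rightarrow> 'a set set" where
  "dual_complex r E \<F> = generated_complex {E - F | F. F \<in> \<F> \<and> card F = r}"

lemma dual_complex_iff: "H \<in> dual_complex r E \<F> \<longleftrightarrow> (\<exists>F\<in>\<F>. card F = r \<and> H \<subseteq> E - F)"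
  by (auto simp: dual_complex_def generated_complex_def)

lemma simplicial_complex_dual_complex:
  assumes "finite E"
  shows "simplicial_complex (dual_complex r E \<F>)"
proof -
  have "\<Union>(dual_complex r E \<F>) \<subseteq> E"
    by (auto simp: dual_complex_iff)
  then have "finite (\<Union>(dual_complex r E \<F>))"
    using assms by (rule finite_subset)
  then show ?thesis
    unfolding simplicial_complex_def Ball_def dual_complex_iff by (meson order_trans)
qed

lemma greedoid_augment:
  assumes "greedoid E \<F>" "X \<in> \<F>" "Y \<in> \<F>" "card Y < card X"
  obtains x where "x \<in> X" "x \<notin> Y" "insert x Y \<in> \<F>"
  using assms unfolding greedoid_def by blast

lemma greedoid_ground:
  assumes "greedoid E \<F>"
  shows "finite E" "\<F> \<subseteq> Pow E" "{} \<in> \<F>"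
  using assms by (simp_all add: greedoid_def)

lemma greedoid_finite:
  assumes "greedoid E \<F>" "F \<in> \<F>"
  shows "finite F"
  using greedoid_ground[OF assms(1)] assms(2) by (auto intro: finite_subset)

text \<open>Augmentation is repeated until the sizes agree; every added element comes from
  \<open>X\<close>, so the result stays inside \<open>X \<union> Y\<close>.\<close>

lemma greedoid_extend:
  assumes "greedoid E \<F>" "X \<in> \<F>" "Y \<in> \<F>" "card Y \<le> card X"
  obtains Z where "Z \<in> \<F>" "Y \<subseteq> Z" "Z \<subseteq> X \<union> Y" "card Z = card X"
proof -
  have "\<exists>Z\<in>\<F>. Y \<subseteq> Z \<and> Z \<subseteq> X \<union> Y \<and> card Z = card X"
    using assms(3,4)
  proof (induction "card X - card Y" arbitrary: Y)
    case 0
    then show ?case by auto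
  next
    case (Suc n)
    have "card Y < card X"
      using Suc.hyps(2) by linarith
    then obtain x where x: "x \<in> X" "x \<notin> Y" "insert x Y \<in> \<F>"
      by (rule greedoid_augment[OF assms(1,2) Suc.prems(1)])
    have "card (insert x Y) = Suc (card Y)"
      using x greedoid_finite[OF assms(1) Suc.prems(1)] by simp
    then have "n = card X - card (insert x Y)" "card (insert x Y) \<le> card X"
      using Suc.hyps(2) by linarith+
    then obtain Z where "Z \<in> \<F>" "insert x Y \<subseteq> Z" "Z \<subseteq> X \<union> insert x Y" "card Z = card X"
      using Suc.hyps(1)[OF _ x(3)] by blast
    then show ?case using x(1) by auto
  qed
  then show ?thesis using that by blast
qed

lemma greedoid_restrict:
  assumes "greedoid E \<F>"
  shows "greedoid (E - {x}) {F \<in> \<F>. x \<notin> F}"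
  unfolding greedoid_def
proof (intro conjI ballI impI)
  fix X Y assume "X \<in> {F \<in> \<F>. x \<notin> F}" "Y \<in> {F \<in> \<F>. x \<notin> F}" "card Y < card X"
  then obtain z where "z \<in> X" "z \<notin> Y" "insert z Y \<in> \<F>"
    using greedoid_augment[OF assms] by blast
  then show "\<exists>z\<in>X - Y. insert z Y \<in> {F \<in> \<F>. x \<notin> F}"
    using \<open>X \<in> _\<close> \<open>Y \<in> _\<close> by auto
qed (use greedoid_ground[OF assms] in auto)

text \<open>Adding \<open>x\<close> to both sets keeps the size gap, and an element augmenting
  \<open>insert x Y\<close> differs from \<open>x\<close>, so it lies in
  \<open>X - Y\<close>.\<close>

lemma greedoid_contract:
  assumes "greedoid E \<F>" "{x} \<in> \<F>"
  shows "greedoid (E - {x}) {F. x \<notin> F \<and> insert x F \<in> \<F>}"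
  unfolding greedoid_def
proof (intro conjI ballI impI)
  fix X Y
  assume X: "X \<in> {F. x \<notin> F \<and> insert x F \<in> \<F>}" and Y: "Y \<in> {F. x \<notin> F \<and> insert x F \<in> \<F>}"
    and less: "card Y < card X"
  have "card (insert x Y) < card (insert x X)"
    using X Y less greedoid_finite[OF assms(1), of "insert x X"]
      greedoid_finite[OF assms(1), of "insert x Y"] by auto
  then obtain z where "z \<in> insert x X" "z \<notin> insert x Y" "insert z (insert x Y) \<in> \<F>"
    using greedoid_augment[OF assms(1)] X Y by blast
  then show "\<exists>z\<in>X - Y. insert z Y \<in> {F. x \<notin> F \<and> insert x F \<in> \<F>}"
    using Y by (auto simp: insert_commute)
qed (use greedoid_ground[OF assms(1)] assms(2) in auto)

lemma link_dual_complex: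
  assumes "x \<in> E"
  shows "link (dual_complex r E \<F>) x = dual_complex r (E - {x}) {F \<in> \<F>. x \<notin> F}"
  using assms by (fastforce simp: link_def dual_complex_iff)

lemma deletion_dual_complex:
  assumes "greedoid E \<F>" "{x} \<in> \<F>"
  shows "deletion (dual_complex (Suc r) E \<F>) x =
    dual_complex r (E - {x}) {F. x \<notin> F \<and> insert x F \<in> \<F>}" (is "?L = ?R")
proof (intro set_eqI iffI)
  fix H assume "H \<in> ?L"
  then obtain F where F: "F \<in> \<F>" "card F = Suc r" "H \<subseteq> E - F" "x \<notin> H"
    by (auto simp: deletion_def dual_complex_iff)
  \<comment> \<open>If \<open>x\<close> is not in \<open>F\<close>, then \<open>Z\<close> trades one
    element of \<open>F\<close> for \<open>x\<close>. As \<open>x\<close> is not in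
    \<open>H\<close>, the set \<open>Z\<close> still misses \<open>H\<close>.\<close>
  then obtain Z where Z: "Z \<in> \<F>" "{x} \<subseteq> Z" "Z \<subseteq> F \<union> {x}" "card Z = Suc r"
    using greedoid_extend[OF assms(1) F(1) assms(2)] by auto
  have "card (Z - {x}) = r"
    using Z by auto
  moreover have "insert x (Z - {x}) = Z"
    using Z by auto
  ultimately show "H \<in> ?R"
    using F Z by (auto simp: dual_complex_iff intro!: exI[of _ "Z - {x}"])
next
  fix H assume "H \<in> ?R"
  then obtain F where F: "x \<notin> F" "insert x F \<in> \<F>" "card F = r" "H \<subseteq> E - {x} - F"
    by (auto simp: dual_complex_iff)
  then have "card (insert x F) = Suc r"
    using greedoid_finite[OF assms(1) F(2)] by simp
  then show "H \<in> ?L"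
    using F by (auto simp: deletion_def dual_complex_iff intro!: bexI[of _ "insert x F"])
qed

text \<open>The generators are complements of sets of one common size, so none properly contains
  another. The shedding condition thus becomes a comparison of feasible sets.\<close>

lemma facets_dual_complex:
  assumes "greedoid E \<F>"
  shows "facets (dual_complex r E \<F>) = {E - F | F. F \<in> \<F> \<and> card F = r}" (is "?L = ?R")
proof (intro set_eqI iffI)
  fix H assume "H \<in> ?L"
  then obtain F where F: "F \<in> \<F>" "card F = r" "H \<subseteq> E - F"
    and max: "\<And>K. K \<in> dual_complex r E \<F> \<Longrightarrow> H \<subseteq> K \<Longrightarrow> K = H"
    by (auto simp: facets_def dual_complex_iff)
  have "E - F \<in> dual_complex r E \<F>"
    using F by (auto simp: dual_complex_iff)
  then show "H \<in> ?R"
    using max F by blast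
next
  fix H assume "H \<in> ?R"
  then obtain F where F: "F \<in> \<F>" "card F = r" and H: "H = E - F"
    by blast
  have "K = H" if "K \<in> dual_complex r E \<F>" "H \<subseteq> K" for K
  proof -
    obtain F' where F': "F' \<in> \<F>" "card F' = r" "K \<subseteq> E - F'"
      using \<open>K \<in> _\<close> by (auto simp: dual_complex_iff)
    have "F' \<subseteq> F"
      using F' H that(2) greedoid_ground(2)[OF assms] by blast
    then have "F' = F"
      using F F' greedoid_finite[OF assms] by (metis card_subset_eq)
    then show ?thesis
      using F' H that(2) by blast
  qed
  then show "H \<in> ?L"
    using F H by (auto simp: facets_def dual_complex_iff)
qed

theorem vertex_decomposable_dual_complex:
  assumes "greedoid E \<F>"
  shows "vertex_decomposable (dual_complex r E \<F>)"
  using assms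
\<comment> \<open>Link and deletion both live on \<open>E - {x}\<close>, with other feasible sets
  and, for the deletion, a smaller \<open>r\<close>.\<close>
proof (induction "card E" arbitrary: E \<F> r rule: less_induct)
  case less
  note G = \<open>greedoid E \<F>\<close>
  have fin: "finite E" and empty: "{} \<in> \<F>" and sub: "\<F> \<subseteq> Pow E"
    by (fact greedoid_ground[OF G])+
  show ?case
  proof (cases r)
    case 0
    \<comment> \<open>Feasible sets are finite, so size 0 really means empty; the complex is then
      the full simplex on \<open>E\<close>.\<close>
    have "F = {}" if "F \<in> \<F>" "card F = 0" for F
      using that greedoid_finite[OF G] by auto
    then have "dual_complex r E \<F> = Pow E"
      using 0 empty by (auto simp: dual_complex_iff intro!: bexI[of _ "{}"])
    then show ?thesis
      using fin by (simp add: vertex_decomposable.simplex)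
  next
    case (Suc n)
    show ?thesis
    proof (cases "dual_complex r E \<F> = {}")
      case True
      then show ?thesis by (simp add: vertex_decomposable.void_complex)
    next
      case False
      then obtain H where "H \<in> dual_complex r E \<F>"
        by blast
      then obtain F where F: "F \<in> \<F>" "card F = r"
        by (auto simp: dual_complex_iff)
      \<comment> \<open>Augmenting \<open>{}\<close> from the nonempty feasible set \<open>F\<close>
        yields a feasible singleton.\<close>
      then obtain x where x: "{x} \<in> \<F>"
        using greedoid_augment[OF G F(1) empty] Suc by auto
      then have "x \<in> E"
        using sub by auto
      then have smaller: "card (E - {x}) < card E"
        using fin by (rule card_Diff1_less[rotated])
      have del: "vertex_decomposable (deletion (dual_complex r E \<F>) x)"
        unfolding Suc deletion_dual_complex[OF G x]
        by (rule less.hyps[OF smaller greedoid_contract[OF G x]])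
      show ?thesis
      proof (cases "{x} \<in> dual_complex r E \<F>")
        case True
        have "facets (deletion (dual_complex r E \<F>) x) \<subseteq> facets (dual_complex r E \<F>)"
        proof
          fix H assume "H \<in> facets (deletion (dual_complex r E \<F>) x)"
          then obtain F where F: "x \<notin> F" "insert x F \<in> \<F>" "card F = n" "H = E - {x} - F"
            unfolding Suc deletion_dual_complex[OF G x]
              facets_dual_complex[OF greedoid_contract[OF G x]] by auto
          have "card (insert x F) = r"
            using F Suc greedoid_finite[OF G F(2)] by simp
          moreover have "H = E - insert x F"
            using F by auto
          ultimately show "H \<in> facets (dual_complex r E \<F>)"
            using F unfolding facets_dual_complex[OF G] by blast
        qed
        moreover have "vertex_decomposable (link (dual_complex r E \<F>) x)"
          unfolding link_dual_complex[OF \<open>x \<in> E\<close>]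
          by (rule less.hyps[OF smaller greedoid_restrict[OF G]])
        ultimately show ?thesis
          using True del simplicial_complex_dual_complex[OF fin]
          by (blast intro: vertex_decomposable.shedding_vertex)
      next
        \<comment> \<open>Here \<open>x\<close> belongs to every feasible set of size
          \<open>r\<close>.\<close>
        case False
        then have "x \<notin> H" if "H \<in> dual_complex r E \<F>" for H
          using that by (fastforce simp: dual_complex_iff)
        then have "deletion (dual_complex r E \<F>) x = dual_complex r E \<F>"
          by (auto simp: deletion_def)
        then show ?thesis
          using del by simp
      qed
    qed
  qed
qed

section \<open>The greedoid of connected extensions\<close>

text \<open>Recasting connectedness as an edge across every cut suits augmentation, which only asks
  for one edge leaving a given set.\<close>

lemma connected_induce_iff_cut:
  "connected (G \<restriction> S) \<longleftrightarrow>
    S \<noteq> {} \<and> (\<forall>T. T \<subset> S \<longrightarrow> T \<noteq> {} \<longrightarrow> (\<exists>u\<in>T. \<exists>v\<in>S - T. (u, v) \<in> (arcs_ends G)\<^sup>s))"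
  (is "_ \<longleftrightarrow> _ \<and> ?cut")
proof -
  let ?R = "(arcs_ends (G \<restriction> S))\<^sup>s"
  have R: "(u, v) \<in> ?R \<longleftrightarrow> u \<in> S \<and> v \<in> S \<and> (u, v) \<in> (arcs_ends G)\<^sup>s" for u v
    by (auto simp: arcs_ends_conv symcl_def)
  have ?cut if conn: "\<forall>u\<in>S. \<forall>v\<in>S. (u, v) \<in> rtrancl_on S ?R"
  proof (intro allI impI)
    fix T assume T: "T \<subset> S" "T \<noteq> {}"
    then obtain u v where "u \<in> T" "v \<in> S" "v \<notin> T"
      by blast
    with T conn have "(u, v) \<in> rtrancl_on S ?R"
      by blast
    \<comment> \<open>Invariant along a walk from \<open>u\<close>: it is still in \<open>T\<close>,
      or an edge across the cut has been found.\<close>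
    then have "v \<in> T \<or> (\<exists>u\<in>T. \<exists>v\<in>S - T. (u, v) \<in> (arcs_ends G)\<^sup>s)"
    proof (induction rule: rtrancl_on_induct)
      case base
      then show ?case using \<open>u \<in> T\<close> by blast
    next
      case (step y z)
      then show ?case by (auto simp: R)
    qed
    with \<open>v \<notin> T\<close> show "\<exists>u\<in>T. \<exists>v\<in>S - T. (u, v) \<in> (arcs_ends G)\<^sup>s"
      by blast
  qed
  moreover have "(u, v) \<in> rtrancl_on S ?R" if ?cut "u \<in> S" "v \<in> S" for u v
  proof (rule ccontr)
    \<comment> \<open>The cut is the set reachable from \<open>u\<close>; an edge leaving it would
      reach a new vertex.\<close>
    let ?T = "{w. (u, w) \<in> rtrancl_on S ?R}"
    assume "(u, v) \<notin> rtrancl_on S ?R"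
    then have "?T \<subset> S"
      using \<open>v \<in> S\<close> by (auto dest: in_rtrancl_on_in_F)
    moreover have "?T \<noteq> {}"
      using \<open>u \<in> S\<close> by auto
    ultimately obtain y z where "(u, y) \<in> rtrancl_on S ?R" "z \<in> S"
      "(u, z) \<notin> rtrancl_on S ?R" "(y, z) \<in> (arcs_ends G)\<^sup>s"
      using \<open>?cut\<close> by blast
    then show False
      by (metis R rtrancl_on_into_rtrancl_on in_rtrancl_on_in_F(2))
  qed
  ultimately have "?cut \<longleftrightarrow> (\<forall>u\<in>S. \<forall>v\<in>S. (u, v) \<in> rtrancl_on S ?R)"
    by (intro iffI ballI)
  then show ?thesis
    by (simp only: connected_conv induce_subgraph_verts)
qed

lemma connected_induce_insert:
  assumes "connected (G \<restriction> S)" "u \<in> S" "(u, v) \<in> (arcs_ends G)\<^sup>s"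
  shows "connected (G \<restriction> insert v S)"
  unfolding connected_induce_iff_cut
proof (intro conjI allI impI)
  fix T assume T: "T \<subset> insert v S" "T \<noteq> {}"
  have vu: "(v, u) \<in> (arcs_ends G)\<^sup>s"
    using assms(3) by (auto simp: symcl_def)
  have cut: "\<exists>x\<in>U. \<exists>y\<in>S - U. (x, y) \<in> (arcs_ends G)\<^sup>s" if "U \<subset> S" "U \<noteq> {}" for U
    using assms(1) that unfolding connected_induce_iff_cut by blast
  \<comment> \<open>Either \<open>T\<close> is \<open>S\<close> or \<open>{v}\<close>, and the edge
    between \<open>u\<close> and \<open>v\<close> crosses, or \<open>T\<close> splits
    \<open>S\<close> and an edge inside \<open>S\<close> crosses.\<close>
  consider "S \<subseteq> T" | "T \<inter> S = {}" | "T \<inter> S \<subset> S" "T \<inter> S \<noteq> {}"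
    by blast
  then show "\<exists>x\<in>T. \<exists>y\<in>insert v S - T. (x, y) \<in> (arcs_ends G)\<^sup>s"
  proof cases
    case 1
    then show ?thesis using T assms(2,3) by blast
  next
    case 2
    then show ?thesis using T assms(2) vu by blast
  next
    case 3
    then show ?thesis using cut[of "T \<inter> S"] by blast
  qed
qed simp

lemma greedoid_connected_extensions:
  assumes "finite (verts G)" "A \<noteq> {}" "connected (G \<restriction> A)"
  shows "greedoid (verts G - A) {F. F \<subseteq> verts G - A \<and> connected (G \<restriction> (F \<union> A))}"
    (is "greedoid ?E ?\<F>")
  unfolding greedoid_def
proof (intro conjI ballI impI)
  fix X Y assume X: "X \<in> ?\<F>" and Y: "Y \<in> ?\<F>" and less: "card Y < card X"
  have "finite Y"
    using Y assms(1) by (auto intro: finite_subset)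
  then have "\<not> X \<subseteq> Y"
    using less by (meson card_mono not_le)
  \<comment> \<open>This cut of the connected set \<open>X \<union> A\<close> contains
    \<open>A\<close>, so it is nonempty. A crossing edge ends outside \<open>Y \<union> A\<close>,
    hence at a vertex of \<open>X\<close> that can be attached to \<open>Y\<close>.\<close>
  then have "(Y \<union> A) \<inter> (X \<union> A) \<subset> X \<union> A" "(Y \<union> A) \<inter> (X \<union> A) \<noteq> {}"
    using X assms(2) by auto
  then obtain u v where uv: "u \<in> Y \<union> A" "v \<in> X" "v \<notin> Y \<union> A" "(u, v) \<in> (arcs_ends G)\<^sup>s"
    using X unfolding mem_Collect_eq connected_induce_iff_cut by blast
  then have "connected (G \<restriction> insert v (Y \<union> A))"
    using Y by (blast intro: connected_induce_insert)
  then show "\<exists>x\<in>X - Y. insert x Y \<in> ?\<F>"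
    using uv X Y by auto
qed (use assms in auto)

theorem theorem3p7:
  fixes G :: "('a, 'b) pre_digraph" and A :: "'a set" and r :: nat
  assumes "graph G"
    and "A \<subseteq> verts G"
    and "A \<noteq> {}"
    and "connected (G \<restriction> A)"
    and "r \<ge> 1"
  shows "vertex_decomposable (co_connected_complex r A G)"
proof -
  interpret graph G by fact
  let ?\<F> = "{F. F \<subseteq> verts G - A \<and> connected (G \<restriction> (F \<union> A))}"
  \<comment> \<open>Over the ground set \<open>verts G - A\<close>, the generator given by
    \<open>F\<close> is just the complement of \<open>F\<close>.\<close>
  have "F \<in> supp r A G \<longleftrightarrow> F \<in> ?\<F> \<and> card F = r" for F
    by (auto simp: supp_def)
  then have "{verts G - F - A | F. F \<in> supp r A G} = {verts G - A - F | F. F \<in> ?\<F> \<and> card F = r}"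
    by (simp add: Diff_eq Int_ac)
  then have "co_connected_complex r A G = dual_complex r (verts G - A) ?\<F>"
    by (simp add: co_connected_complex_def dual_complex_def)
  then show ?thesis
    using greedoid_connected_extensions[of G A] vertex_decomposable_dual_complex assms by simp
qed

end
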